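(* Let $\mathcal{L}$ be an LTS with state set $P$ satisfying cn-enabled, let $\mathcal{T}\in\mathcal{A}(N)$, and let $\mathbb{A}$ be a label abstraction that abstracts $(\mathcal{L},\mathcal{T})$. For all sets $X,Y\subseteq P$, if $X\sqsubseteq^{set}_{\mathbb{A}}Y$ then $X\sqsubseteq^{set}_{\mathcal{T}}Y$.
   Context: $\mathsf{Act}$ countable set of visible actions, $\tau\notin\mathsf{Act}$, $\mathsf{L}=\mathsf{Act}\cup\{\tau\}$, involutive duality $\mu\mapsto\overline{\mu}$; $N\subseteq\mathsf{Act}$ non-blocking, $B=\mathsf{Act}\setminus N$. LTSs are finite-image. cn-enabled: every state $p$ and $\eta\in N$ have some $q$ with $p\xrightarrow{\overline{\eta}}q$. $\mathcal{A}(N)$: LTSs satisfying for all $\alpha\in\mathsf{L}$, $\eta\in N$, $\mu\in\mathsf{Act}$, $\mu\ne\eta$: N-delay ($p_1\xrightarrow{\eta}p_2\xrightarrow{\alpha}p_3\Rightarrow\exists p_4.\,p_1\xrightarrow{\alpha}p_4\xrightarrow{\eta}p_3$), N-confluence ($p_1\xrightarrow{\eta}p_2$, $p_1\xrightarrow{\mu}p_3\Rightarrow\exists p_4.\,p_2\xrightarrow{\mu}p_4,\ p_3\xrightarrow{\eta}p_4$), N-determinacy, backwards-N-determinacy ($p_1\xrightarrow{\eta}p_2,p_1\xrightarrow{\eta}p_3\Rightarrow p_2=p_3$; $p_2\xrightarrow{\eta}p_1,p_3\xrightarrow{\eta}p_1\Rightarrow p_2=p_3$), N-tau ($p_1\xrightarrow{\eta}p_2,p_1\xrightarrow{\tau}p_3$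 imply $\exists p_4.\,p_2\xrightarrow{\tau}p_4,\ p_3\xrightarrow{\eta}p_4$, or $p_2\xrightarrow{\overline{\eta}}p_3$), Feedback ($p\xrightarrow{\eta}q\xrightarrow{\overline{\eta}}q'\Rightarrow p\xrightarrow{\tau}q'$). Testing: the composition of program $p$ and test $t$ steps via $\tau$-moves of either side or via $p\xrightarrow{\overline{\mu}}p'$, $t\xrightarrow{\mu}t'$, $\mu\in\mathsf{Act}$; good is a decidable predicate on tests preserved in both directions by $N$-transitions; Must$(p,t)$ iff every maximal computation from $(p,t)$ contains a state with good test; $\mathrm{Must}_{set}(Z,t)$ iff Must$(p,t)$ for all $p\in Z$; $Z\sqsubseteq^{set}_{\mathcal{T}}W$ iff for every test $t$ of $\mathcal{T}$, $\mathrm{Must}_{set}(Z,t)\Rightarrow\mathrm{Must}_{set}(W,t)$. $R(t)=\{\mu:t\xrightarrow{\mu}\}$, $\mathrm{coR}(p)=\{\beta\in B:p\xrightarrow{\overline{\beta}}\}$. Label abstraction $\mathbb{A}=(\phi:B\to Y,\delta:Y\to X_{\mathbb{A}})$, $\mathrm{coR}_{\mathbb{A}}(p)=\{\delta(\phi(\beta)):\beta\in\mathrm{coR}(p)\}$; it abstracts $(\mathcal{L},\mathcal{T})$ if for all $\beta,\beta'\in B$: (i) for every test $t$, $\phi(\beta)=\phi(\beta')$, $\beta\in R(t)$ imply $\beta'\in R(t)$; (ii) for every $p\in P$, $\delta(\phi(\beta))=\delta(\phi(\beta'))$, $\phi(\beta)\in\phi(\mathrm{coR}(p))$ imply $\phi(\beta')\in\phi(\mathrm{coR}(p))$.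 $\mathsf{toSet}(\mathcal{L})$: states subsets of $P$, $Z\xrightarrow{\alpha}\{q:\exists p\in Z.\,p\xrightarrow{\alpha}q\}$. Convergence $\Downarrow s$: no state reached by a weak transition along a prefix of $s$ has an infinite $\tau$-sequence (for sets, in $\mathsf{toSet}(\mathcal{L})$). $\mathrm{ws}(p,s)=\{q:p\overset{s}{\Rightarrow}q\not\xrightarrow{\tau}\}$, $[\![p]\!](s)=\{\mathrm{coR}_{\mathbb{A}}(q):q\in\mathrm{ws}(p,s)\}$, $[\![Z]\!]_{set}(s)=\bigcup_{p\in Z}[\![p]\!](s)$. $\mathcal{A}\ll\mathcal{B}$ iff each $x\in\mathcal{B}$ has some $y\in\mathcal{A}$, $y\subseteq x$. $Z\sqsubseteq^{set}_{\mathbb{A}}W$ iff for all $s\in\mathsf{Act}^*$, $Z\Downarrow s$ implies $W\Downarrow s$ and $[\![Z]\!]_{set}(s)\ll[\![W]\!]_{set}(s)$.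
   Formalization: The set X is assumed finite (Y is arbitrary), since the claim fails for infinite X (X all finite a-chains, Y the infinite one); and in toSet(L) a transition requires a non-empty target set, as otherwise the empty set would have a τ-loop and no set would converge. *)

theory Defs
  imports Main "HOL-Library.Countable" "HOL-Library.Extended_Nat" "HOL-Library.Sublist"
begin

section \<open>Labelled transition systems\<close>

text \<open>The type \<open>'a\<close> plays the role of the set \<open>Act\<close> of visible actions, the state set of
  an LTS is its state type, and \<open>B\<close> is the complement \<open>- N\<close>.\<close>

datatype 'a label = Tau | Vis 'a

type_synonym ('s, 'a) lts = "'s \<Rightarrow> 'a label \<Rightarrow> 's \<Rightarrow> bool"

definition finite_image :: "('s, 'a) lts \<Rightarrow> bool" where
  "finite_image L \<longleftrightarrow> (\<forall>p \<alpha>. finite {q. L p \<alpha> q})"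

definition involutive :: "('a \<Rightarrow> 'a) \<Rightarrow> bool" where
  "involutive dual \<longleftrightarrow> (\<forall>\<mu>. dual (dual \<mu>) = \<mu>)"

definition cn_enabled :: "('a \<Rightarrow> 'a) \<Rightarrow> 'a set \<Rightarrow> ('s, 'a) lts \<Rightarrow> bool" where
  "cn_enabled dual N L \<longleftrightarrow> (\<forall>p. \<forall>\<eta>\<in>N. \<exists>q. L p (Vis (dual \<eta>)) q)"

section \<open>The class A(N)\<close>

definition N_delay :: "'a set \<Rightarrow> ('s, 'a) lts \<Rightarrow> bool" where
  "N_delay N L \<longleftrightarrow> (\<forall>\<eta>\<in>N. \<forall>\<alpha> p1 p2 p3.
     L p1 (Vis \<eta>) p2 \<longrightarrow> L p2 \<alpha> p3 \<longrightarrow> (\<exists>p4. L p1 \<alpha> p4 \<and> L p4 (Vis \<eta>) p3))"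

definition N_confluence :: "'a set \<Rightarrow> ('s, 'a) lts \<Rightarrow> bool" where
  "N_confluence N L \<longleftrightarrow> (\<forall>\<eta>\<in>N. \<forall>\<mu> p1 p2 p3. \<mu> \<noteq> \<eta> \<longrightarrow>
     L p1 (Vis \<eta>) p2 \<longrightarrow> L p1 (Vis \<mu>) p3 \<longrightarrow> (\<exists>p4. L p2 (Vis \<mu>) p4 \<and> L p3 (Vis \<eta>) p4))"

definition N_determinacy :: "'a set \<Rightarrow> ('s, 'a) lts \<Rightarrow> bool" where
  "N_determinacy N L \<longleftrightarrow> (\<forall>\<eta>\<in>N. \<forall>p1 p2 p3.
     L p1 (Vis \<eta>) p2 \<longrightarrow> L p1 (Vis \<eta>) p3 \<longrightarrow> p2 = p3)"

definition backwards_N_determinacy :: "'a set \<Rightarrow> ('s, 'a) lts \<Rightarrow> bool" where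
  "backwards_N_determinacy N L \<longleftrightarrow> (\<forall>\<eta>\<in>N. \<forall>p1 p2 p3.
     L p2 (Vis \<eta>) p1 \<longrightarrow> L p3 (Vis \<eta>) p1 \<longrightarrow> p2 = p3)"

definition N_tau :: "('a \<Rightarrow> 'a) \<Rightarrow> 'a set \<Rightarrow> ('s, 'a) lts \<Rightarrow> bool" where
  "N_tau dual N L \<longleftrightarrow> (\<forall>\<eta>\<in>N. \<forall>p1 p2 p3.
     L p1 (Vis \<eta>) p2 \<longrightarrow> L p1 Tau p3 \<longrightarrow>
       (\<exists>p4. L p2 Tau p4 \<and> L p3 (Vis \<eta>) p4) \<or> L p2 (Vis (dual \<eta>)) p3)"

definition feedback :: "('a \<Rightarrow> 'a) \<Rightarrow> 'a set \<Rightarrow> ('s, 'a) lts \<Rightarrow> bool" where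
  "feedback dual N L \<longleftrightarrow> (\<forall>\<eta>\<in>N. \<forall>p q q'.
     L p (Vis \<eta>) q \<longrightarrow> L q (Vis (dual \<eta>)) q' \<longrightarrow> L p Tau q')"

definition class_A :: "('a \<Rightarrow> 'a) \<Rightarrow> 'a set \<Rightarrow> ('s, 'a) lts set" where
  "class_A dual N = {L. N_delay N L \<and> N_confluence N L \<and> N_determinacy N L \<and>
     backwards_N_determinacy N L \<and> N_tau dual N L \<and> feedback dual N L}"

section \<open>Testing\<close>

inductive comp_step :: "('a \<Rightarrow> 'a) \<Rightarrow> ('p, 'a) lts \<Rightarrow> ('t, 'a) lts \<Rightarrow> 'p \<times> 't \<Rightarrow> 'p \<times> 't \<Rightarrow> bool"
  for dual :: "'a \<Rightarrow> 'a" and L :: "('p, 'a) lts" and T :: "('t, 'a) lts" where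
  program_tau: "L p Tau p' \<Longrightarrow> comp_step dual L T (p, t) (p', t)"
| test_tau: "T t Tau t' \<Longrightarrow> comp_step dual L T (p, t) (p, t')"
| communication: "L p (Vis (dual \<mu>)) p' \<Longrightarrow> T t (Vis \<mu>) t' \<Longrightarrow>
    comp_step dual L T (p, t) (p', t')"

definition good_preserved :: "'a set \<Rightarrow> ('t, 'a) lts \<Rightarrow> ('t \<Rightarrow> bool) \<Rightarrow> bool" where
  "good_preserved N T good \<longleftrightarrow> (\<forall>\<eta>\<in>N. \<forall>t t'. T t (Vis \<eta>) t' \<longrightarrow> (good t \<longleftrightarrow> good t'))"

text \<open>A computation with \<open>n\<close> steps, \<open>n\<close> possibly infinite, is given by the states \<open>c i\<close> with
  \<open>enat i \<le> n\<close>; the values of \<open>c\<close> beyond \<open>n\<close> are irrelevant.\<close>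

definition maximal_computation :: "('c \<Rightarrow> 'c \<Rightarrow> bool) \<Rightarrow> 'c \<Rightarrow> (nat \<Rightarrow> 'c) \<Rightarrow> enat \<Rightarrow> bool" where
  "maximal_computation step x c n \<longleftrightarrow>
     c 0 = x \<and> (\<forall>i. enat i < n \<longrightarrow> step (c i) (c (Suc i))) \<and>
     (\<forall>k. n = enat k \<longrightarrow> (\<nexists>y. step (c k) y))"

definition must ::
  "('a \<Rightarrow> 'a) \<Rightarrow> ('p, 'a) lts \<Rightarrow> ('t, 'a) lts \<Rightarrow> ('t \<Rightarrow> bool) \<Rightarrow> 'p \<Rightarrow> 't \<Rightarrow> bool" where
  "must dual L T good p t \<longleftrightarrow> (\<forall>c n.
     maximal_computation (comp_step dual L T) (p, t) c n \<longrightarrow> (\<exists>i. enat i \<le> n \<and> good (snd (c i))))"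

definition must_set ::
  "('a \<Rightarrow> 'a) \<Rightarrow> ('p, 'a) lts \<Rightarrow> ('t, 'a) lts \<Rightarrow> ('t \<Rightarrow> bool) \<Rightarrow> 'p set \<Rightarrow> 't \<Rightarrow> bool" where
  "must_set dual L T good Z t \<longleftrightarrow> (\<forall>p\<in>Z. must dual L T good p t)"

definition test_preorder_set ::
  "('a \<Rightarrow> 'a) \<Rightarrow> ('p, 'a) lts \<Rightarrow> ('t, 'a) lts \<Rightarrow> ('t \<Rightarrow> bool) \<Rightarrow> 'p set \<Rightarrow> 'p set \<Rightarrow> bool" where
  "test_preorder_set dual L T good Z W \<longleftrightarrow>
     (\<forall>t. must_set dual L T good Z t \<longrightarrow> must_set dual L T good W t)"

section \<open>Label abstractions\<close>

definition R :: "('t, 'a) lts \<Rightarrow> 't \<Rightarrow> 'a set" where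
  "R T t = {\<mu>. \<exists>t'. T t (Vis \<mu>) t'}"

definition coR :: "('a \<Rightarrow> 'a) \<Rightarrow> 'a set \<Rightarrow> ('p, 'a) lts \<Rightarrow> 'p \<Rightarrow> 'a set" where
  "coR dual N L p = {\<beta> \<in> - N. \<exists>q. L p (Vis (dual \<beta>)) q}"

text \<open>The map \<open>\<phi>\<close>, whose domain is \<open>B\<close>, is rendered as a total function that is only ever
  applied to elements of \<open>- N\<close>.\<close>

definition coR_abs ::
  "('a \<Rightarrow> 'a) \<Rightarrow> 'a set \<Rightarrow> ('a \<Rightarrow> 'y) \<Rightarrow> ('y \<Rightarrow> 'x) \<Rightarrow> ('p, 'a) lts \<Rightarrow> 'p \<Rightarrow> 'x set" where
  "coR_abs dual N \<phi> \<delta> L p = (\<lambda>\<beta>. \<delta> (\<phi> \<beta>)) ` coR dual N L p"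

definition abstracts ::
  "('a \<Rightarrow> 'a) \<Rightarrow> 'a set \<Rightarrow> ('a \<Rightarrow> 'y) \<Rightarrow> ('y \<Rightarrow> 'x) \<Rightarrow> ('p, 'a) lts \<Rightarrow> ('t, 'a) lts \<Rightarrow> bool" where
  "abstracts dual N \<phi> \<delta> L T \<longleftrightarrow> (\<forall>\<beta>\<in>- N. \<forall>\<beta>'\<in>- N.
     (\<forall>t. \<phi> \<beta> = \<phi> \<beta>' \<longrightarrow> \<beta> \<in> R T t \<longrightarrow> \<beta>' \<in> R T t) \<and>
     (\<forall>p. \<delta> (\<phi> \<beta>) = \<delta> (\<phi> \<beta>') \<longrightarrow> \<phi> \<beta> \<in> \<phi> ` coR dual N L p \<longrightarrow> \<phi> \<beta>' \<in> \<phi> ` coR dual N L p))"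

section \<open>Convergence and the alternative preorder\<close>

inductive weak :: "('s, 'a) lts \<Rightarrow> 's \<Rightarrow> 'a list \<Rightarrow> 's \<Rightarrow> bool" for L :: "('s, 'a) lts" where
  weak_refl: "weak L p [] p"
| weak_tau: "L p Tau q \<Longrightarrow> weak L q s r \<Longrightarrow> weak L p s r"
| weak_vis: "L p (Vis \<mu>) q \<Longrightarrow> weak L q s r \<Longrightarrow> weak L p (\<mu> # s) r"

definition diverges :: "('s, 'a) lts \<Rightarrow> 's \<Rightarrow> bool" where
  "diverges L p \<longleftrightarrow> (\<exists>f. f 0 = p \<and> (\<forall>i. L (f i) Tau (f (Suc i))))"

definition converges :: "('s, 'a) lts \<Rightarrow> 's \<Rightarrow> 'a list \<Rightarrow> bool" where
  "converges L p s \<longleftrightarrow> (\<forall>s' q. prefix s' s \<longrightarrow> weak L p s' q \<longrightarrow> \<not> diverges L q)"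

text \<open>A transition to the empty set is not a transition: otherwise the empty set would have a
  \<open>\<tau>\<close>-loop and be reachable from every set, and no set would converge.\<close>

definition toSet :: "('s, 'a) lts \<Rightarrow> ('s set, 'a) lts" where
  "toSet L Z \<alpha> Z' \<longleftrightarrow> Z' = {q. \<exists>p\<in>Z. L p \<alpha> q} \<and> Z' \<noteq> {}"

definition ws :: "('s, 'a) lts \<Rightarrow> 's \<Rightarrow> 'a list \<Rightarrow> 's set" where
  "ws L p s = {q. weak L p s q \<and> (\<nexists>q'. L q Tau q')}"

definition acc ::
  "('a \<Rightarrow> 'a) \<Rightarrow> 'a set \<Rightarrow> ('a \<Rightarrow> 'y) \<Rightarrow> ('y \<Rightarrow> 'x) \<Rightarrow> ('p, 'a) lts \<Rightarrow> 'p \<Rightarrow> 'a list \<Rightarrow> 'x set set" where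
  "acc dual N \<phi> \<delta> L p s = coR_abs dual N \<phi> \<delta> L ` ws L p s"

definition acc_set ::
  "('a \<Rightarrow> 'a) \<Rightarrow> 'a set \<Rightarrow> ('a \<Rightarrow> 'y) \<Rightarrow> ('y \<Rightarrow> 'x) \<Rightarrow> ('p, 'a) lts \<Rightarrow> 'p set \<Rightarrow> 'a list \<Rightarrow> 'x set set" where
  "acc_set dual N \<phi> \<delta> L Z s = (\<Union>p\<in>Z. acc dual N \<phi> \<delta> L p s)"

definition ll :: "'x set set \<Rightarrow> 'x set set \<Rightarrow> bool" where
  "ll \<A> \<B> \<longleftrightarrow> (\<forall>x\<in>\<B>. \<exists>y\<in>\<A>. y \<subseteq> x)"

definition alt_preorder_set ::
  "('a \<Rightarrow> 'a) \<Rightarrow> 'a set \<Rightarrow> ('a \<Rightarrow> 'y) \<Rightarrow> ('y \<Rightarrow> 'x) \<Rightarrow> ('p, 'a) lts \<Rightarrow> 'p set \<Rightarrow> 'p set \<Rightarrow> bool" where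
  "alt_preorder_set dual N \<phi> \<delta> L Z W \<longleftrightarrow> (\<forall>s. converges (toSet L) Z s \<longrightarrow>
     converges (toSet L) W s \<and> ll (acc_set dual N \<phi> \<delta> L Z s) (acc_set dual N \<phi> \<delta> L W s))"

end

theory Submission
  imports Defs
begin

text \<open>Take a maximal computation of \<open>(q, t)\<close>, \<open>q \<in> Y\<close>, that meets no good test, and unzip it into a
  run of \<open>q\<close> and a run of the test. If \<open>X\<close> diverges along a prefix of the trace of \<open>q\<close>, then by
  Koenig's lemma some \<open>p \<in> X\<close> does, and zipping \<open>p\<close> with the test run gives an unsuccessful
  computation. Otherwise the acceptance sets of \<open>X\<close> and \<open>Y\<close> can be compared along the whole trace.
  If the computation is finite, \<open>X\<close> reaches a stable \<open>p'\<close> whose abstract co-actions are among those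
  of the final state of \<open>q\<close>; as the latter cannot communicate with the final test, neither can \<open>p'\<close>
  (non-blocking actions of the test are excluded since programs are always ready for them). If it is
  infinite, convergence of \<open>Y\<close> makes the test move infinitely often, and Koenig's lemma yields a
  single \<open>p \<in> X\<close> that follows the test forever.\<close>

section \<open>Infinite sequences\<close>

text \<open>The pigeonhole step of Koenig's lemma. If every candidate failed at some index, the
  largest of these finitely many indices would defeat them all, as \<open>Q\<close> is inherited by
  smaller indices.\<close>

lemma finite_uniform_witness:
  assumes fin: "finite A" and ex: "\<And>j::nat. \<exists>a\<in>A. Q a j"
    and anti: "\<And>a i j. i \<le> j \<Longrightarrow> Q a j \<Longrightarrow> Q a i"
  shows "\<exists>a\<in>A. \<forall>j. Q a j"
proof (rule ccontr)
  assume "\<not> ?thesis"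
  then obtain J where J: "\<And>a. a \<in> A \<Longrightarrow> \<not> Q a (J a)" by metis
  obtain a where a: "a \<in> A" "Q a (Max (J ` A))" using ex by blast
  have "J a \<le> Max (J ` A)" using fin a(1) by simp
  then show False using anti[OF _ a(2)] J[OF a(1)] by blast
qed

lemma infinite_chain:
  assumes "P x" and "\<And>x. P x \<Longrightarrow> \<exists>y. r x y \<and> P y"
  shows "\<exists>f. f 0 = x \<and> (\<forall>i::nat. r (f i) (f (Suc i)))"
proof -
  have "\<exists>f. \<forall>n. (P (f n) \<and> (n = 0 \<longrightarrow> f n = x)) \<and> r (f n) (f (Suc n))"
    by (rule dependent_nat_choice) (use assms in auto)
  then show ?thesis by auto
qed

text \<open>Flattens macro steps into single \<open>r\<close>-steps. \<open>I\<close> may fail in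
  between, so the invariant is weakened to the reachability of a state satisfying
  \<open>I\<close>.\<close>

lemma infinite_chain_tranclp:
  assumes I: "I x" and step: "\<And>x. I x \<Longrightarrow> \<exists>y. r\<^sup>+\<^sup>+ x y \<and> I y"
  shows "\<exists>f. f 0 = x \<and> (\<forall>i::nat. r (f i) (f (Suc i)))"
proof (rule infinite_chain[where P = "\<lambda>x. \<exists>y. r\<^sup>*\<^sup>* x y \<and> I y"])
  show "\<exists>y. r\<^sup>*\<^sup>* x y \<and> I y" using I by blast
next
  fix x assume "\<exists>y. r\<^sup>*\<^sup>* x y \<and> I y"
  then obtain y where y: "r\<^sup>*\<^sup>* x y" "I y" by blast
  obtain z where z: "r\<^sup>+\<^sup>+ y z" "I z" using step[OF y(2)] by blast
  have "r\<^sup>+\<^sup>+ x z" using y(1) z(1) by (rule rtranclp_tranclp_tranclp)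
  then obtain x' where "r x x'" "r\<^sup>*\<^sup>* x' z" by (blast dest: tranclpD)
  then show "\<exists>x'. r x x' \<and> (\<exists>y. r\<^sup>*\<^sup>* x' y \<and> I y)" using z(2) by blast
qed

section \<open>Weak transitions and convergence\<close>

lemma weak_append:
  "weak L p s q \<Longrightarrow> weak L q u r \<Longrightarrow> weak L p (s @ u) r"
  by (induction rule: weak.induct) (auto intro: weak.intros)

lemma weak_appendE:
  assumes "weak L p (s @ u) r"
  obtains q where "weak L p s q" "weak L q u r"
proof -
  have "\<exists>q. weak L p s q \<and> weak L q u r"
    using assms
  proof (induction p "s @ u" r arbitrary: s rule: weak.induct)
    case (weak_refl p)
    then show ?case by (auto intro: weak.intros)
  next
    case (weak_tau p q r)
    then show ?case by (blast intro: weak.intros)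
  next
    case (weak_vis p \<mu> q v r)
    then show ?case
      by (cases s) (fastforce intro: weak.intros)+
  qed
  then show thesis using that by blast
qed

lemma weak_ConsE:
  assumes "weak L p (\<mu> # s) r"
  obtains q q' where "weak L p [] q" "L q (Vis \<mu>) q'" "weak L q' s r"
proof -
  have "\<exists>q q'. weak L p [] q \<and> L q (Vis \<mu>) q' \<and> weak L q' s r"
    using assms
    by (induction p "\<mu> # s" r rule: weak.induct) (blast intro: weak.intros)+
  then show thesis using that by blast
qed

lemma diverges_if_tau: "L p Tau q \<Longrightarrow> diverges L q \<Longrightarrow> diverges L p"
  unfolding diverges_def
proof -
  assume pq: "L p Tau q" and "\<exists>f. f 0 = q \<and> (\<forall>i. L (f i) Tau (f (Suc i)))"
  then obtain f where f: "f 0 = q" "\<And>i. L (f i) Tau (f (Suc i))" by blast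
  have "L (case_nat p f i) Tau (case_nat p f (Suc i))" for i
    using pq f by (cases i) auto
  then show "\<exists>f. f 0 = p \<and> (\<forall>i. L (f i) Tau (f (Suc i)))"
    by (intro exI[of _ "case_nat p f"]) simp
qed

text \<open>A counterexample would always have a \<open>Tau\<close>-successor that is again a
  counterexample, and would hence diverge.\<close>

lemma not_diverges_induct [consumes 1, case_names step]:
  assumes nd: "\<not> diverges L p"
    and step: "\<And>p. \<not> diverges L p \<Longrightarrow> (\<And>q. L p Tau q \<Longrightarrow> P q) \<Longrightarrow> P p"
  shows "P p"
proof (rule ccontr)
  assume "\<not> P p"
  have "\<exists>f. f 0 = p \<and> (\<forall>i. L (f i) Tau (f (Suc i)))"
  proof (rule infinite_chain[where P = "\<lambda>p. \<not> diverges L p \<and> \<not> P p" and r = "\<lambda>p q. L p Tau q"])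
    show "\<not> diverges L p \<and> \<not> P p" using nd \<open>\<not> P p\<close> by blast
    show "\<exists>q. L p Tau q \<and> \<not> diverges L q \<and> \<not> P q" if "\<not> diverges L p \<and> \<not> P p" for p
      using that step[of p] diverges_if_tau[of L p] by blast
  qed
  then show False using nd unfolding diverges_def by blast
qed

lemma not_diverges_stable:
  "\<not> diverges L p \<Longrightarrow> \<exists>q. weak L p [] q \<and> (\<nexists>q'. L q Tau q')"
  by (induction rule: not_diverges_induct) (metis weak.intros(1,2))

lemma finite_weak_Nil:
  assumes "finite_image L" and "\<not> diverges L p"
  shows "finite {q. weak L p [] q}"
  using assms(2)
proof (induction rule: not_diverges_induct)
  case (step p)
  have "{q. weak L p [] q} \<subseteq> insert p (\<Union>r\<in>{r. L p Tau r}. {q. weak L r [] q})"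
    by (auto elim: weak.cases)
  moreover have "finite {r. L p Tau r}" using assms(1) unfolding finite_image_def by blast
  ultimately show ?case using step.IH by (auto elim: finite_subset)
qed

lemma converges_weak:
  assumes "converges L p (s @ u)" and "weak L p s q"
  shows "converges L q u"
  unfolding converges_def
proof (intro allI impI)
  fix u' r assume "prefix u' u" "weak L q u' r"
  then have "prefix (s @ u') (s @ u)" "weak L p (s @ u') r"
    using weak_append[OF assms(2)] by auto
  then show "\<not> diverges L r" using assms(1) unfolding converges_def by blast
qed

lemma converges_not_diverges: "converges L p s \<Longrightarrow> \<not> diverges L p"
  unfolding converges_def by (metis Nil_prefix weak_refl)

lemma finite_weak:
  assumes "finite_image L" and "converges L p s"
  shows "finite {q. weak L p s q}"
  using assms(2)
proof (induction s arbitrary: p)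
  case Nil
  then show ?case by (intro finite_weak_Nil[OF assms(1)] converges_not_diverges)
next
  case (Cons \<mu> s)
  \<comment> \<open>\<open>?A\<close> stops right after the first visible action; later internal
    moves are left to \<open>s\<close>.\<close>
  let ?A = "\<Union>r\<in>{r. weak L p [] r}. {r'. L r (Vis \<mu>) r'}"
  have "finite ?A"
    using finite_weak_Nil[OF assms(1) converges_not_diverges[OF Cons.prems]] assms(1)
    by (auto simp: finite_image_def)
  moreover have "finite {q. weak L r' s q}" if "r' \<in> ?A" for r'
  proof -
    from that obtain r where "weak L p [] r" "L r (Vis \<mu>) r'" by blast
    then have "weak L p ([] @ [\<mu>]) r'" by (intro weak_append) (auto intro: weak.intros)
    then have "weak L p [\<mu>] r'" by simp
    then have "converges L r' s" using converges_weak[of L p "[\<mu>]" s r'] Cons.prems by simp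
    then show ?thesis by (rule Cons.IH)
  qed
  moreover have "{q. weak L p (\<mu> # s) q} \<subseteq> (\<Union>r'\<in>?A. {q. weak L r' s q})"
    by (blast elim: weak_ConsE)
  ultimately show ?case by (rule finite_subset[rotated, OF finite_UN_I])
qed

section \<open>Lifting weak transitions, divergence and convergence to sets of states\<close>

lemma toSet_image: "p \<in> Z \<Longrightarrow> L p \<alpha> q \<Longrightarrow> \<exists>Z'. toSet L Z \<alpha> Z' \<and> q \<in> Z'"
  unfolding toSet_def by blast

lemma weak_toSet: "weak L p s q \<Longrightarrow> p \<in> Z \<Longrightarrow> \<exists>Z'. weak (toSet L) Z s Z' \<and> q \<in> Z'"
proof (induction arbitrary: Z rule: weak.induct)
  case (weak_refl p)
  then show ?case by (blast intro: weak.intros)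
next
  case (weak_tau p q s r)
  obtain Z' where "toSet L Z Tau Z'" "q \<in> Z'"
    using toSet_image[of p Z L Tau q] weak_tau.prems weak_tau.hyps(1) by blast
  then show ?case using weak_tau.IH by (blast intro: weak.intros)
next
  case (weak_vis p \<mu> q s r)
  obtain Z' where "toSet L Z (Vis \<mu>) Z'" "q \<in> Z'"
    using toSet_image[of p Z L "Vis \<mu>" q] weak_vis.prems weak_vis.hyps(1) by blast
  then show ?case using weak_vis.IH by (blast intro: weak.intros)
qed

lemma weak_toSetD:
  assumes "finite_image L" and "weak (toSet L) Z s Z'" and "finite Z"
  shows "finite Z' \<and> (\<forall>q\<in>Z'. \<exists>p\<in>Z. weak L p s q)"
  using assms(2,3)
proof (induction rule: weak.induct)
  case (weak_refl Z)
  then show ?case by (blast intro: weak.intros)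
next
  case (weak_tau Z Z1 s Z2)
  from weak_tau.hyps(1) have Z1: "Z1 = (\<Union>p\<in>Z. {q. L p Tau q})" unfolding toSet_def by blast
  have "finite Z1" unfolding Z1 using weak_tau.prems assms(1) by (simp add: finite_image_def)
  with weak_tau.IH have "finite Z2" "\<forall>q\<in>Z2. \<exists>p\<in>Z1. weak L p s q" by auto
  then show ?case unfolding Z1 by (blast intro: weak.intros)
next
  case (weak_vis Z \<mu> Z1 s Z2)
  from weak_vis.hyps(1) have Z1: "Z1 = (\<Union>p\<in>Z. {q. L p (Vis \<mu>) q})" unfolding toSet_def by blast
  have "finite Z1" unfolding Z1 using weak_vis.prems assms(1) by (simp add: finite_image_def)
  with weak_vis.IH have "finite Z2" "\<forall>q\<in>Z2. \<exists>p\<in>Z1. weak L p s q" by auto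
  then show ?case unfolding Z1 by (blast intro: weak.intros)
qed

lemma diverges_toSet:
  assumes "diverges L q" and "q \<in> Z"
  shows "diverges (toSet L) Z"
  unfolding diverges_def
proof (rule infinite_chain[where P = "\<lambda>Z. \<exists>q\<in>Z. diverges L q" and r = "\<lambda>Z Z'. toSet L Z Tau Z'"])
  show "\<exists>q\<in>Z. diverges L q" using assms by blast
next
  fix Z assume "\<exists>q\<in>Z. diverges L q"
  then obtain q f where q: "q \<in> Z" "f 0 = q" and f: "\<And>i. L (f i) Tau (f (Suc i))"
    unfolding diverges_def by blast
  have "diverges L (f 1)"
    unfolding diverges_def by (rule exI[of _ "\<lambda>i. f (Suc i)"]) (use f in auto)
  then show "\<exists>Z'. toSet L Z Tau Z' \<and> (\<exists>q\<in>Z'. diverges L q)"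
    using toSet_image[OF q(1), of L Tau "f 1"] f[of 0] q(2) by auto
qed

text \<open>Koenig's lemma on the forest of internal moves: nonempty sets \<open>F i\<close> give
  arbitrarily long paths from \<open>Z\<close>, and finiteness of \<open>Z\<close> and of the
  branching yields one infinite path. In an infinite \<open>Z\<close>, members without infinite
  paths could still have paths of unbounded length.\<close>

lemma diverges_toSetD:
  assumes "finite_image L" and "diverges (toSet L) Z" and "finite Z"
  shows "\<exists>q\<in>Z. diverges L q"
proof (rule ccontr)
  assume nd: "\<not> ?thesis"
  obtain F where F: "F 0 = Z" "\<And>i. toSet L (F i) Tau (F (Suc i))"
    using assms(2) unfolding diverges_def by blast
  define r where "r = (\<lambda>p q. L p Tau q)"
  have reach: "\<exists>p\<in>Z. (r ^^ i) p q" if "q \<in> F i" for i q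
    using that
  proof (induction i arbitrary: q)
    case 0
    then show ?case using F(1) by auto
  next
    case (Suc i)
    then obtain p where "p \<in> F i" "r p q" using F(2)[of i] unfolding toSet_def r_def by blast
    then show ?case using Suc.IH by (meson relpowp_Suc_I)
  qed
  have down: "\<exists>y. (r ^^ i) a y" if "i \<le> j" "\<exists>y. (r ^^ j) a y" for a i j
  proof -
    from that(1) have "j = i + (j - i)" by simp
    then show ?thesis using that(2) by (metis relcomppE relpowp_add)
  qed
  have nonempty: "F i \<noteq> {}" if "i > 0" for i
    using F(2)[of "i - 1"] that unfolding toSet_def by (metis Suc_diff_1)
  have "\<exists>a\<in>Z. \<forall>j. \<exists>y. (r ^^ j) a y"
  proof (rule finite_uniform_witness[OF assms(3)])
    fix j
    \<comment> \<open>Index \<open>Suc j\<close>, since \<open>toSet\<close> asserts nonemptiness of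
      the targets of transitions only.\<close>
    obtain q where "q \<in> F (Suc j)" using nonempty by blast
    then obtain p where "p \<in> Z" "(r ^^ Suc j) p q" using reach by blast
    then show "\<exists>a\<in>Z. \<exists>y. (r ^^ j) a y" using down[of j "Suc j" p] by (meson le_SucI order_refl)
  qed (rule down)
  then obtain a where a: "a \<in> Z" "\<forall>j. \<exists>y. (r ^^ j) a y" by blast
  have "\<exists>f. f 0 = a \<and> (\<forall>i. r (f i) (f (Suc i)))"
  proof (rule infinite_chain[where P = "\<lambda>a. \<forall>j. \<exists>y. (r ^^ j) a y"])
    fix a assume long: "\<forall>j. \<exists>y. (r ^^ j) a y"
    have "\<exists>b\<in>{b. r a b}. \<forall>j. \<exists>y. (r ^^ j) b y"
    proof (rule finite_uniform_witness)
      show "finite {b. r a b}" using assms(1) unfolding finite_image_def r_def by blast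
      show "\<exists>b\<in>{b. r a b}. \<exists>y. (r ^^ j) b y" for j
        using long[rule_format, of "Suc j"] by (metis mem_Collect_eq relpowp_Suc_D2)
    qed (rule down)
    then show "\<exists>b. r a b \<and> (\<forall>j. \<exists>y. (r ^^ j) b y)" by blast
  qed (rule a(2))
  then have "diverges L a" unfolding diverges_def r_def .
  then show False using nd a(1) by blast
qed

lemma converges_toSetD: "converges (toSet L) Z s \<Longrightarrow> p \<in> Z \<Longrightarrow> converges L p s"
  unfolding converges_def by (meson diverges_toSet weak_toSet)

lemma converges_toSetI:
  assumes "finite_image L" and "finite Z" and "\<And>p. p \<in> Z \<Longrightarrow> converges L p s"
  shows "converges (toSet L) Z s"
  unfolding converges_def
proof (intro allI impI notI)
  fix s' Z' assume s': "prefix s' s" and w: "weak (toSet L) Z s' Z'" and d: "diverges (toSet L) Z'"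
  note Z' = weak_toSetD[OF assms(1) w assms(2)]
  then obtain q where "q \<in> Z'" "diverges L q" using diverges_toSetD[OF assms(1) d] by blast
  moreover from this(1) Z' obtain p where "p \<in> Z" "weak L p s' q" by blast
  ultimately show False using assms(3) s' unfolding converges_def by blast
qed

section \<open>Unsuccessful computations\<close>

text \<open>Only the source must be unsuccessful, so that such a step can be prepended to any
  computation of its target.\<close>

definition bad_step ::
  "('a \<Rightarrow> 'a) \<Rightarrow> ('p, 'a) lts \<Rightarrow> ('t, 'a) lts \<Rightarrow> ('t \<Rightarrow> bool) \<Rightarrow> 'p \<times> 't \<Rightarrow> 'p \<times> 't \<Rightarrow> bool" where
  "bad_step dual L T good x y \<longleftrightarrow> comp_step dual L T x y \<and> \<not> good (snd x)"

lemma must_bad_step: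
  assumes "must dual L T good (fst x) (snd x)" and "bad_step dual L T good x y"
  shows "must dual L T good (fst y) (snd y)"
  unfolding must_def
proof (intro allI impI)
  fix c n assume "maximal_computation (comp_step dual L T) (fst y, snd y) c n"
  then have c0: "c 0 = y" and cs: "\<And>i. enat i < n \<Longrightarrow> comp_step dual L T (c i) (c (Suc i))"
    and cm: "\<And>k. n = enat k \<Longrightarrow> \<nexists>y. comp_step dual L T (c k) y"
    unfolding maximal_computation_def by auto
  \<comment> \<open>\<open>case_nat x c\<close> puts \<open>x\<close> in front of \<open>c\<close>,
    and \<open>eSuc\<close> covers finite and infinite lengths alike. As \<open>x\<close> is
    unsuccessful, the success lies in \<open>c\<close>.\<close>
  have "maximal_computation (comp_step dual L T) (fst x, snd x) (case_nat x c) (eSuc n)"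
    unfolding maximal_computation_def
  proof (intro conjI allI impI)
    show "comp_step dual L T (case_nat x c i) (case_nat x c (Suc i))" if "enat i < eSuc n" for i
      using that assms(2) c0 cs by (cases i) (auto simp: bad_step_def simp flip: eSuc_enat)
    show "\<nexists>y. comp_step dual L T (case_nat x c k) y" if "eSuc n = enat k" for k
      using that cm by (cases k) (auto simp: zero_enat_def[symmetric] simp flip: eSuc_enat)
  qed simp
  then obtain i where i: "enat i \<le> eSuc n" "good (snd (case_nat x c i))"
    using assms(1) unfolding must_def by blast
  then obtain j where "i = Suc j" using assms(2) by (cases i) (auto simp: bad_step_def)
  with i show "\<exists>i. enat i \<le> n \<and> good (snd (c i))" by (auto simp flip: eSuc_enat)
qed

lemma must_bad_steps:
  "(bad_step dual L T good)\<^sup>*\<^sup>* x y \<Longrightarrow> must dual L T good (fst x) (snd x) \<Longrightarrow>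
    must dual L T good (fst y) (snd y)"
  by (induction rule: rtranclp_induct) (blast intro: must_bad_step)+

lemma must_not_stuck:
  assumes "must dual L T good p t" and "\<not> good t"
  shows "\<exists>y. comp_step dual L T (p, t) y"
proof (rule ccontr)
  assume "\<not> ?thesis"
  then have "maximal_computation (comp_step dual L T) (p, t) (\<lambda>_. (p, t)) 0"
    unfolding maximal_computation_def by simp
  then show False using assms unfolding must_def by fastforce
qed

lemma must_no_infinite_bad_run:
  assumes "must dual L T good (fst (f 0)) (snd (f 0))"
    and bad: "\<And>i. bad_step dual L T good (f i) (f (Suc i))"
  shows False
proof -
  have "maximal_computation (comp_step dual L T) (f 0) f \<infinity>"
    using bad unfolding maximal_computation_def bad_step_def by simp
  then obtain i where "good (snd (f i))" using assms(1) unfolding must_def by auto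
  then show False using bad[of i] unfolding bad_step_def by blast
qed

lemma must_not_diverges:
  assumes "must dual L T good p t" and "\<not> good t"
  shows "\<not> diverges L p"
proof
  assume "diverges L p"
  then obtain f where f: "f 0 = p" "\<And>i. L (f i) Tau (f (Suc i))" unfolding diverges_def by blast
  show False
    by (rule must_no_infinite_bad_run[of dual L T good "\<lambda>i. (f i, t)"])
      (use f assms in \<open>auto simp: bad_step_def intro: program_tau\<close>)
qed

lemma weak_Nil_bad_steps:
  fixes L :: "('p, 'a) lts"
  assumes "weak L p [] q" and "\<not> good t"
  shows "(bad_step dual L T good)\<^sup>*\<^sup>* (p, t) (q, t)"
  using assms(1)
proof (induction p "[] :: 'a list" q rule: weak.induct)
  case (weak_tau p q r)
  then have "bad_step dual L T good (p, t) (q, t)"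
    using assms(2) by (auto simp: bad_step_def intro: program_tau)
  then show ?case using weak_tau by (meson converse_rtranclp_into_rtranclp)
qed simp

section \<open>Unzipping a computation\<close>

text \<open>\<open>w\<close> is the trace as seen by the program, hence the dual of the action of
  the test.\<close>

definition test_move ::
  "('a \<Rightarrow> 'a) \<Rightarrow> ('t, 'a) lts \<Rightarrow> 't \<Rightarrow> 'a list \<Rightarrow> 't \<Rightarrow> bool" where
  "test_move dual T t w t' \<longleftrightarrow> w = [] \<and> T t Tau t' \<or> (\<exists>\<mu>. w = [dual \<mu>] \<and> T t (Vis \<mu>) t')"

lemma comp_step_unzip:
  assumes "comp_step dual L T x y"
  shows "\<exists>w. weak L (fst x) w (fst y) \<and>
    (w = [] \<and> snd y = snd x \<and> L (fst x) Tau (fst y) \<or> test_move dual T (snd x) w (snd y))"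
  using assms
proof cases
  case (program_tau p p' t)
  then show ?thesis by (intro exI[of _ "[]"]) (auto intro: weak.intros)
next
  case (test_tau t t' p)
  then show ?thesis by (intro exI[of _ "[]"]) (auto simp: test_move_def intro: weak.intros)
next
  case (communication p \<mu> p' t t')
  then show ?thesis
    by (intro exI[of _ "[dual \<mu>]"]) (auto simp: test_move_def intro: weak.intros)
qed

text \<open>Internal moves of the program surround the move of the test. Those after it happen with
  test \<open>t'\<close>, which must therefore be unsuccessful too.\<close>

lemma test_move_zip:
  assumes "test_move dual T t w t'" and "weak L p w p'" and "\<not> good t" and "\<not> good t'"
  shows "(bad_step dual L T good)\<^sup>+\<^sup>+ (p, t) (p', t')"
proof -
  have "\<exists>q q'. weak L p [] q \<and> comp_step dual L T (q, t) (q', t') \<and> weak L q' [] p'"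
  proof (cases "w = []")
    case True
    then have "T t Tau t'" using assms(1) by (auto simp: test_move_def)
    then show ?thesis using True assms(2) by (blast intro: weak_refl test_tau)
  next
    case False
    then obtain \<mu> where "w = [dual \<mu>]" "T t (Vis \<mu>) t'" using assms(1) by (auto simp: test_move_def)
    then show ?thesis using assms(2) by (blast elim: weak_ConsE intro: communication)
  qed
  then obtain q q' where "weak L p [] q" "comp_step dual L T (q, t) (q', t')" "weak L q' [] p'"
    by blast
  then have "(bad_step dual L T good)\<^sup>*\<^sup>* (p, t) (q, t)" "bad_step dual L T good (q, t) (q', t')"
    "(bad_step dual L T good)\<^sup>*\<^sup>* (q', t') (p', t')"
    using assms(3,4) by (auto simp: bad_step_def intro: weak_Nil_bad_steps)
  then show ?thesis by (meson rtranclp_into_tranclp1 tranclp_rtranclp_tranclp)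
qed

text \<open>\<open>w i\<close> is what the program contributes to the trace in step \<open>i\<close>: it is empty for an internal step,
  and in a step of the program alone the test stays put.\<close>

locale unzipped =
  fixes dual :: "'a \<Rightarrow> 'a" and L :: "('p, 'a) lts" and T :: "('t, 'a) lts" and good :: "'t \<Rightarrow> bool"
    and q :: "nat \<Rightarrow> 'p" and t :: "nat \<Rightarrow> 't" and w :: "nat \<Rightarrow> 'a list" and n :: enat
  assumes program: "enat i < n \<Longrightarrow> weak L (q i) (w i) (q (Suc i))"
    and test: "enat i < n \<Longrightarrow> w i = [] \<and> t (Suc i) = t i \<and> L (q i) Tau (q (Suc i)) \<or>
      test_move dual T (t i) (w i) (t (Suc i))"
    and not_good: "enat i \<le> n \<Longrightarrow> \<not> good (t i)"
begin

abbreviation bad :: "'p \<times> 't \<Rightarrow> 'p \<times> 't \<Rightarrow> bool" where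
  "bad \<equiv> bad_step dual L T good"

definition seg :: "nat \<Rightarrow> nat \<Rightarrow> 'a list" where
  "seg i j = concat (map w [i..<j])"

lemma seg_same [simp]: "seg i i = []"
  by (simp add: seg_def)

lemma seg_Suc: "i \<le> j \<Longrightarrow> seg i (Suc j) = seg i j @ w j"
  by (simp add: seg_def)

lemma seg_split: "i \<le> j \<Longrightarrow> j \<le> k \<Longrightarrow> seg i k = seg i j @ seg j k"
  unfolding seg_def by (metis concat_append le_add_diff_inverse map_append upt_add_eq_append)

lemma enat_bounds: "enat (Suc i) \<le> n \<Longrightarrow> enat i < n" "enat (Suc i) \<le> n \<Longrightarrow> enat i \<le> n"
  by (auto simp: Suc_ile_eq intro: less_imp_le)

text \<open>Another program replaces \<open>q i\<close> while the test run is kept. Where the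
  original step was one of the program alone, the replacement may idle, so the closure is only
  reflexive.\<close>

lemma zip_step:
  assumes "enat (Suc i) \<le> n" and "weak L p (w i) p'"
  shows "bad\<^sup>*\<^sup>* (p, t i) (p', t (Suc i))"
  using test[OF enat_bounds(1)[OF assms(1)]]
proof
  assume "w i = [] \<and> t (Suc i) = t i \<and> L (q i) Tau (q (Suc i))"
  then show ?thesis
    using assms not_good[OF enat_bounds(2)[OF assms(1)]] by (auto intro: weak_Nil_bad_steps)
next
  assume "test_move dual T (t i) (w i) (t (Suc i))"
  then show ?thesis
    by (intro tranclp_into_rtranclp test_move_zip[OF _ assms(2)] not_good assms(1) enat_bounds(2))
qed

lemma zip:
  "enat i \<le> n \<Longrightarrow> weak L p (seg 0 i) p' \<Longrightarrow> bad\<^sup>*\<^sup>* (p, t 0) (p', t i)"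
proof (induction i arbitrary: p')
  case 0
  then show ?case using not_good by (auto intro: weak_Nil_bad_steps)
next
  case (Suc i)
  then obtain r where "weak L p (seg 0 i) r" "weak L r (w i) p'"
    by (auto simp: seg_Suc elim: weak_appendE)
  then show ?case using Suc.IH[of r] zip_step[OF Suc.prems(1)] enat_bounds(2)[OF Suc.prems(1)]
    by (meson rtranclp_trans)
qed

lemma program_run: "enat i \<le> n \<Longrightarrow> weak L (q 0) (seg 0 i) (q i)"
proof (induction i)
  case (Suc i)
  then show ?case using program[of i] enat_bounds[OF Suc.prems] by (auto simp: seg_Suc intro: weak_append)
qed (simp add: weak_refl)

text \<open>Each \<open>w i\<close> has at most one action, so the trace grows letter by
  letter.\<close>

lemma prefix_seg: "enat i \<le> n \<Longrightarrow> prefix s (seg 0 i) \<Longrightarrow> \<exists>j\<le>i. s = seg 0 j"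
proof (induction i)
  case (Suc i)
  have "length (w i) \<le> 1"
    using test[OF enat_bounds(1)[OF Suc.prems(1)]] by (auto simp: test_move_def)
  then have "w i = [] \<or> (\<exists>a. w i = [a])" by (cases "w i") auto
  then have "prefix s (seg 0 i) \<or> s = seg 0 (Suc i)"
    using Suc.prems(2) by (auto simp: seg_Suc)
  then show ?case using Suc.IH enat_bounds(2)[OF Suc.prems(1)] le_SucI by blast
qed simp

text \<open>A state reached along a prefix meets, by zipping, an unsuccessful test of the run. It
  inherits \<open>must\<close> from \<open>p\<close> and so cannot diverge.\<close>

lemma must_converges:
  assumes "must dual L T good p (t 0)" and i: "enat i \<le> n"
  shows "converges L p (seg 0 i)"
  unfolding converges_def
proof (intro allI impI)
  fix s r assume "prefix s (seg 0 i)" and r: "weak L p s r"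
  then obtain j where j: "j \<le> i" "s = seg 0 j" using prefix_seg[OF i] by blast
  then have jn: "enat j \<le> n" using i by (meson enat_ord_simps(1) order_trans)
  have "must dual L T good r (t j)"
    using must_bad_steps[OF zip[OF jn]] assms(1) r j(2) by fastforce
  then show "\<not> diverges L r" using must_not_diverges[where good = good] not_good[OF jn] by metis
qed

text \<open>\<open>trace\<close> may supply a different member of \<open>Z\<close> for each length;
  Koenig's lemma extracts a single one. \<open>moves\<close> prevents the zipped run from idling
  forever.\<close>

lemma infinite_zip:
  assumes n: "n = \<infinity>" and L: "finite_image L" and Z: "finite Z"
    and conv: "\<And>i p. p \<in> Z \<Longrightarrow> converges L p (seg 0 i)"
    and trace: "\<And>i. \<exists>p\<in>Z. \<exists>p'. weak L p (seg 0 i) p'"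
    and moves: "\<And>i. \<exists>j\<ge>i. test_move dual T (t j) (w j) (t (Suc j))"
  shows "\<exists>p\<in>Z. \<not> must dual L T good p (t 0)"
proof -
  \<comment> \<open>The first conjunct gives convergence, hence finitely many successors; the second
    keeps every finite continuation of the trace possible.\<close>
  define G where "G p i \<longleftrightarrow>
    (\<exists>x\<in>Z. weak L x (seg 0 i) p) \<and> (\<forall>k. \<exists>p'. weak L p (seg i (i + k)) p')" for p i
  have down: "\<exists>p'. weak L p (seg i (i + k)) p'"
    if "k \<le> k'" "\<exists>p'. weak L p (seg i (i + k')) p'" for p i k k'
    using that seg_split[of i "i + k" "i + k'"] by (auto elim: weak_appendE)
  have G_step: "\<exists>p'. weak L p (w i) p' \<and> G p' (Suc i)" if "G p i" for p i
  proof -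
    obtain x where x: "x \<in> Z" "weak L x (seg 0 i) p" using \<open>G p i\<close> unfolding G_def by blast
    have "converges L p (w i)"
      using converges_weak[OF _ x(2)] conv[OF x(1), of "Suc i"] by (simp add: seg_Suc)
    then have fin: "finite {r. weak L p (w i) r}" by (rule finite_weak[OF L])
    have "\<exists>r\<in>{r. weak L p (w i) r}. \<forall>k. \<exists>p'. weak L r (seg (Suc i) (Suc i + k)) p'"
    proof (rule finite_uniform_witness[OF fin])
      fix k
      obtain p' where "weak L p (seg i (i + Suc k)) p'" using \<open>G p i\<close> unfolding G_def by blast
      then show "\<exists>r\<in>{r. weak L p (w i) r}. \<exists>p'. weak L r (seg (Suc i) (Suc i + k)) p'"
        using seg_split[of i "Suc i" "i + Suc k"] seg_Suc[of i i] by (fastforce elim: weak_appendE)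
    qed (rule down)
    then show ?thesis
      using x weak_append[OF x(2)] unfolding G_def by (auto simp: seg_Suc)
  qed
  have G_steps: "\<exists>p'. bad\<^sup>*\<^sup>* (p, t i) (p', t (i + k)) \<and> G p' (i + k)" if "G p i" for p i k
  proof (induction k)
    case (Suc k)
    then obtain p' where p': "bad\<^sup>*\<^sup>* (p, t i) (p', t (i + k))" "G p' (i + k)" by blast
    obtain r where "weak L p' (w (i + k)) r" "G r (Suc (i + k))" using G_step[OF p'(2)] by blast
    then show ?case using p'(1) zip_step[of "i + k" p' r] n by (auto intro: rtranclp_trans)
  qed (use that in auto)
  \<comment> \<open>Running on to the next move of the test guarantees a genuine step.\<close>
  have G_move: "\<exists>p' j. bad\<^sup>+\<^sup>+ (p, t i) (p', t j) \<and> G p' j" if "G p i" for p i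
  proof -
    obtain j where j: "j \<ge> i" "test_move dual T (t j) (w j) (t (Suc j))" using moves by blast
    obtain p' where p': "bad\<^sup>*\<^sup>* (p, t i) (p', t j)" "G p' j"
      using G_steps[OF \<open>G p i\<close>, of "j - i"] j(1) by auto
    obtain r where r: "weak L p' (w j) r" "G r (Suc j)" using G_step[OF p'(2)] by blast
    have "bad\<^sup>+\<^sup>+ (p', t j) (r, t (Suc j))" using test_move_zip[OF j(2) r(1)] not_good n by simp
    then show ?thesis using p'(1) r(2) by (meson rtranclp_tranclp_tranclp)
  qed
  have "\<exists>p\<in>Z. \<forall>k. \<exists>p'. weak L p (seg 0 (0 + k)) p'"
    by (rule finite_uniform_witness[OF Z]) (use trace in simp, rule down)
  then obtain p where p: "p \<in> Z" "G p 0" unfolding G_def by (auto intro: weak_refl)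
  have "\<exists>f. f 0 = (p, t 0) \<and> (\<forall>i. bad (f i) (f (Suc i)))"
  proof (rule infinite_chain_tranclp[where I = "\<lambda>x. \<exists>i. snd x = t i \<and> G (fst x) i"])
    show "\<exists>i. snd (p, t 0) = t i \<and> G (fst (p, t 0)) i" using p(2) by auto
    fix x assume "\<exists>i. snd x = t i \<and> G (fst x) i"
    then obtain i where "x = (fst x, t i)" "G (fst x) i" by (metis prod.collapse)
    then show "\<exists>y. bad\<^sup>+\<^sup>+ x y \<and> (\<exists>i. snd y = t i \<and> G (fst y) i)"
      using G_move by (metis fst_conv snd_conv)
  qed
  then obtain f where "f 0 = (p, t 0)" "\<And>i. bad (f i) (f (Suc i))" by blast
  then have "\<not> must dual L T good p (t 0)" using must_no_infinite_bad_run[of dual L T good f] by auto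
  then show ?thesis using p(1) by blast
qed

end

section \<open>Comparison of abstract co-actions and the final argument\<close>

text \<open>For \<open>\<mu>\<close> in \<open>N\<close>, \<open>cn\<close> makes \<open>q\<close>
  ready. Otherwise the second clause of \<open>abstracts\<close> gives a co-action of
  \<open>q\<close> with the same \<open>\<phi>\<close>-value as \<open>\<mu>\<close>, and the first
  makes the test ready for it. Thus \<open>q\<close> may communicate on an action other than
  \<open>\<mu>\<close>.\<close>

lemma abstracts_communication:
  assumes abs: "abstracts dual N \<phi> \<delta> L T" and cn: "cn_enabled dual N L"
    and sub: "coR_abs dual N \<phi> \<delta> L p \<subseteq> coR_abs dual N \<phi> \<delta> L q"
    and p: "L p (Vis (dual \<mu>)) p'" and t: "T t (Vis \<mu>) t'"
  shows "\<exists>y. comp_step dual L T (q, t) y"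
proof (cases "\<mu> \<in> N")
  case True
  then obtain q' where "L q (Vis (dual \<mu>)) q'" using cn unfolding cn_enabled_def by blast
  then show ?thesis using t by (blast intro: communication)
next
  case False
  then have "\<mu> \<in> coR dual N L p" using p unfolding coR_def by blast
  then obtain \<beta> where \<beta>: "\<beta> \<in> coR dual N L q" "\<delta> (\<phi> \<beta>) = \<delta> (\<phi> \<mu>)"
    using sub unfolding coR_abs_def by (metis (no_types, lifting) image_iff subsetD)
  have "\<beta> \<in> - N" using \<beta>(1) unfolding coR_def by blast
  then have "\<phi> \<mu> \<in> \<phi> ` coR dual N L q"
    using abs \<beta> False unfolding abstracts_def by blast
  then obtain \<beta>' where \<beta>': "\<beta>' \<in> coR dual N L q" "\<phi> \<mu> = \<phi> \<beta>'" by blast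
  have "\<mu> \<in> R T t" using t unfolding R_def by blast
  moreover have "\<beta>' \<in> - N" using \<beta>'(1) unfolding coR_def by blast
  ultimately have "\<beta>' \<in> R T t" using abs \<beta>'(2) False unfolding abstracts_def by blast
  then show ?thesis using \<beta>'(1) unfolding R_def coR_def by (blast intro: communication)
qed

theorem proposition19:
  fixes dual :: "'a::countable \<Rightarrow> 'a" and N :: "'a set"
    and L :: "('p, 'a) lts" and T :: "('t, 'a) lts" and good :: "'t \<Rightarrow> bool"
    and \<phi> :: "'a \<Rightarrow> 'y" and \<delta> :: "'y \<Rightarrow> 'x" and X Y :: "'p set"
  assumes "involutive dual"
    and "finite_image L" and "finite_image T"
    and "cn_enabled dual N L"
    and "T \<in> class_A dual N"
    and "good_preserved N T good"
    and "abstracts dual N \<phi> \<delta> L T"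
    and "finite X"
    and "alt_preorder_set dual N \<phi> \<delta> L X Y"
  shows "test_preorder_set dual L T good X Y"
  unfolding test_preorder_set_def must_set_def
proof (intro allI impI ballI, rule ccontr)
  fix t0 q0
  assume mustX: "\<forall>p\<in>X. must dual L T good p t0" and q0: "q0 \<in> Y"
    and "\<not> must dual L T good q0 t0"
  then obtain c n where max: "maximal_computation (comp_step dual L T) (q0, t0) c n"
    and bad: "\<And>i. enat i \<le> n \<Longrightarrow> \<not> good (snd (c i))"
    unfolding must_def by blast
  have c0: "c 0 = (q0, t0)" using max unfolding maximal_computation_def by blast
  define q t where "q i = fst (c i)" and "t i = snd (c i)" for i
  have q_0: "q 0 = q0" and t_0: "t 0 = t0" using c0 by (simp_all add: q_def t_def)
  \<comment> \<open>The existential stands outside the guard so that choice gives a total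
    \<open>w\<close>, arbitrary beyond a finite \<open>n\<close>.\<close>
  have "\<forall>i. \<exists>w. enat i < n \<longrightarrow> weak L (q i) w (q (Suc i)) \<and>
      (w = [] \<and> t (Suc i) = t i \<and> L (q i) Tau (q (Suc i)) \<or> test_move dual T (t i) w (t (Suc i)))"
    using max comp_step_unzip unfolding maximal_computation_def q_def t_def by metis
  then obtain w where w: "\<And>i. enat i < n \<Longrightarrow> weak L (q i) (w i) (q (Suc i)) \<and>
      (w i = [] \<and> t (Suc i) = t i \<and> L (q i) Tau (q (Suc i)) \<or>
       test_move dual T (t i) (w i) (t (Suc i)))"
    by metis
  interpret unzipped dual L T good q t w n
    by unfold_locales (use w bad in \<open>auto simp: t_def\<close>)
  \<comment> \<open>\<open>mustX\<close> rules out the divergent case at every time of the run;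
    finiteness of \<open>X\<close> then lifts convergence to the set.\<close>
  have convX: "converges L p (seg 0 i)" if "enat i \<le> n" "p \<in> X" for i p
    using must_converges that mustX t_0 by blast
  have convY: "converges L q0 (seg 0 i)"
    and ll: "ll (acc_set dual N \<phi> \<delta> L X (seg 0 i)) (acc_set dual N \<phi> \<delta> L Y (seg 0 i))"
    if "enat i \<le> n" for i
  proof -
    have "converges (toSet L) X (seg 0 i)"
      using converges_toSetI[OF assms(2,8)] convX that by blast
    then show "converges L q0 (seg 0 i)"
      and "ll (acc_set dual N \<phi> \<delta> L X (seg 0 i)) (acc_set dual N \<phi> \<delta> L Y (seg 0 i))"
      using assms(9) q0 unfolding alt_preorder_set_def by (auto intro: converges_toSetD)
  qed
  have q_conv: "\<not> diverges L (q i)" if "enat i \<le> n" for i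
    using convY[OF that] program_run[OF that] q_0 unfolding converges_def by blast
  \<comment> \<open>\<open>q i\<close> may have internal moves, so a stable descendant
    \<open>r\<close> stands for it in the acceptance sets of \<open>Y\<close>.\<close>
  have follow: "\<exists>p\<in>X. \<exists>p'. weak L p (seg 0 i) p' \<and> (\<nexists>p''. L p' Tau p'') \<and>
      coR_abs dual N \<phi> \<delta> L p' \<subseteq> coR_abs dual N \<phi> \<delta> L r"
    if i: "enat i \<le> n" and r: "weak L (q i) [] r" "\<nexists>r'. L r Tau r'" for i r
  proof -
    have "weak L q0 (seg 0 i) r" using weak_append[OF program_run[OF i] r(1)] q_0 by simp
    then have "coR_abs dual N \<phi> \<delta> L r \<in> acc_set dual N \<phi> \<delta> L Y (seg 0 i)"
      using q0 r(2) unfolding acc_set_def acc_def ws_def by blast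
    then obtain y where y: "y \<in> acc_set dual N \<phi> \<delta> L X (seg 0 i)" "y \<subseteq> coR_abs dual N \<phi> \<delta> L r"
      using ll[OF i] unfolding ll_def by blast
    then show ?thesis unfolding acc_set_def acc_def ws_def by blast
  qed
  show False
  proof (cases n)
    case (enat k)
    have "\<nexists>y. comp_step dual L T (q k, t k) y"
      using max enat unfolding maximal_computation_def q_def t_def by simp
    then have stuck: "\<And>y. \<not> comp_step dual L T (q k, t k) y" by blast
    have "\<nexists>r. L (q k) Tau r" using stuck program_tau by metis
    then obtain p p' where p: "p \<in> X" "weak L p (seg 0 k) p'" "\<nexists>p''. L p' Tau p''"
      "coR_abs dual N \<phi> \<delta> L p' \<subseteq> coR_abs dual N \<phi> \<delta> L (q k)"
      using follow[of k "q k"] enat weak_refl by fastforce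
    have kn: "enat k \<le> n" using enat by simp
    \<comment> \<open>\<open>p'\<close> is reached without success and \<open>t k\<close> is not
      good, so a further step is forced. It contradicts the stability of \<open>p'\<close> or that
      \<open>q k\<close> and \<open>t k\<close> are stuck.\<close>
    have "must dual L T good p' (t k)"
      using must_bad_steps[OF zip[OF kn p(2)]] mustX p(1) t_0 by simp
    then obtain y where "comp_step dual L T (p', t k) y"
      using must_not_stuck[where good = good] not_good[OF kn] by metis
    then show False
    proof cases
      case (program_tau p'')
      then show False using p(3) by blast
    next
      case (test_tau t')
      then show False using stuck comp_step.test_tau by metis
    next
      case (communication \<mu> p'' t')
      then show False using abstracts_communication[OF assms(7,4) p(4)] stuck by blast
    qed
  next
    case infinity
    have "\<exists>p\<in>X. \<not> must dual L T good p (t 0)"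
    proof (rule infinite_zip[OF infinity assms(2,8)])
      show "converges L p (seg 0 i)" if "p \<in> X" for i p using convX that infinity by simp
      \<comment> \<open>Only the trace given by \<open>follow\<close> matters here; a stable
        descendant exists because \<open>q i\<close> does not diverge.\<close>
      show "\<exists>p\<in>X. \<exists>p'. weak L p (seg 0 i) p'" for i
        using not_diverges_stable[OF q_conv, of i] follow[of i] infinity by fastforce
      show "\<exists>j\<ge>i. test_move dual T (t j) (w j) (t (Suc j))" for i
      proof (rule ccontr)
        assume "\<not> ?thesis"
        \<comment> \<open>From time \<open>i\<close> on, only the program would move.\<close>
        then have "L (q (i + j)) Tau (q (i + Suc j))" for j
          using test[of "i + j"] infinity by auto
        then have "diverges L (q i)"
          unfolding diverges_def by (intro exI[of _ "\<lambda>j. q (i + j)"]) simp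
        then show False using q_conv infinity by simp
      qed
    qed
    then show False using mustX t_0 by blast
  qed
qed

end
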